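(* The myopic heuristic is a $2$-approximation for Cost-per-Click AdWords Assignment: the expected revenue $E\big[\sum_{i=1}^N\min\big(B_i,\sum_tV_{t,i}\big)\big]$ earned by the myopic policy is at least one half of the maximum expected revenue over all adaptive ad-to-keyword assignment policies.
   Context: Cost-per-Click AdWords Assignment. There are $N$ advertisers (index $i$) and $K$ keywords (index $k$). Advertiser $i$ has a budget $B_i\ge0$ and a valuation $v_{i,k}\ge0$ for each keyword $k$. In each of $T$ periods $t$ a keyword $k_t\in\{1,\dots,K\}$ arrives, according to an exogenous stochastic process (its law is not affected by assignments or clicks). In period $t$, having observed $k_t$ and everything that has happened so far, one assigns a set of at most $C$ distinct advertisers to the arriving keyword. If advertiser $i$ is assigned in period $t$, his ad is clicked with probability $P_t^{i,k_t}\in[0,1]$, where the $P_t^{i,k}$ are exogenous and known at time $t$; given these probabilities, clicks are independent across advertisers and of the past. If the ad is clicked, advertiser $i$ pays the minimum of $v_{i,k_t}$ and his remaining budget at time $t$, and this payment is subtracted from his budget; otherwise he pays nothing. $V_{t,i}$ denotes the random payment made by advertiser $i$ in period $t$ (zero if he is not assigned). An adaptive policy chooses the assigned set in period $t$ as a function of the information available up to time $t$ (exogenous processes up to time $t$ and past assignments and clicks). The myopic policy assigns in each period $t$ a set of at most $C$ advertisers maximizing the expected payment collected in that period, i.e. maximizing $\sum_{i\in A}P_t^{i,k_t}\min(v_{i,k_t},b_{t,i})$ over sets $A$ with $|A|\le C$, where $b_{t,i}$ is the remaining budget of advertiser $i$. *)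

theory Defs
  imports "HOL-Probability.Probability"
begin

text \<open>
  Advertisers, keywords and periods are numbered from 0. In \<open>click I t i\<close>, advertiser \<open>i\<close> would be
  clicked in period \<open>t\<close> if he were assigned to the arriving keyword; the clicks of unassigned
  advertisers are neither paid for nor observed.
\<close>

record 'w adwords =
  prob_sp :: "'w measure"
  num_adv :: nat
  num_kw :: nat
  horizon :: nat
  capacity :: nat
  budget :: "nat \<Rightarrow> real"
  valuation :: "nat \<Rightarrow> nat \<Rightarrow> real"  \<comment> \<open>advertiser, keyword\<close>
  keyword :: "nat \<Rightarrow> 'w \<Rightarrow> nat"  \<comment> \<open>period\<close>
  click_prob :: "nat \<Rightarrow> nat \<Rightarrow> nat \<Rightarrow> 'w \<Rightarrow> real"  \<comment> \<open>period, advertiser, keyword\<close>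
  click :: "nat \<Rightarrow> nat \<Rightarrow> 'w \<Rightarrow> bool"  \<comment> \<open>period, advertiser\<close>

text \<open>
  The \<open>\<sigma>\<close>-algebra generated by the exogenous processes in the first \<open>n\<close> periods. The keyword and the
  click probabilities of period \<open>t\<close> are known when the assignment of period \<open>t\<close> is made, so the
  exogenous information available in period \<open>t\<close> is \<open>exo_info I (Suc t)\<close>.
\<close>

definition exo_info :: "('w, 'z) adwords_scheme \<Rightarrow> nat \<Rightarrow> 'w measure" where
  "exo_info I n = sigma (space (prob_sp I))
     ({keyword I s -` A \<inter> space (prob_sp I) |s A. s < n} \<union>
      {click_prob I s i k -` A \<inter> space (prob_sp I) |s i k A.
         s < n \<and> i < num_adv I \<and> k < num_kw I \<and> A \<in> sets borel})"

definition current_prob :: "('w, 'z) adwords_scheme \<Rightarrow> nat \<Rightarrow> nat \<Rightarrow> 'w \<Rightarrow> real" where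
  "current_prob I t i \<omega> = click_prob I t i (keyword I t \<omega>) \<omega>"

definition current_value :: "('w, 'z) adwords_scheme \<Rightarrow> nat \<Rightarrow> nat \<Rightarrow> 'w \<Rightarrow> real" where
  "current_value I t i \<omega> = valuation I i (keyword I t \<omega>)"

text \<open>
  Given the whole path of the exogenous processes, the clicks are independent across advertisers and
  periods, with the prescribed probabilities: the conditional probability of every click pattern
  \<open>c\<close> is the product of the individual probabilities. Conditioning on the future of the exogenous
  processes as well expresses that they are not affected by the clicks.
\<close>

definition clicks_cond_indep :: "('w, 'z) adwords_scheme \<Rightarrow> bool" where
  "clicks_cond_indep I \<longleftrightarrow>
     (\<forall>c :: nat \<Rightarrow> nat \<Rightarrow> bool. AE \<omega> in prob_sp I.
        real_cond_exp (prob_sp I) (exo_info I (horizon I))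
          (indicator {\<omega> \<in> space (prob_sp I).
             \<forall>t < horizon I. \<forall>i < num_adv I. click I t i \<omega> = c t i}) \<omega> =
        (\<Prod>t < horizon I. \<Prod>i < num_adv I.
           if c t i then current_prob I t i \<omega> else 1 - current_prob I t i \<omega>))"

definition cpc_adwords :: "('w, 'z) adwords_scheme \<Rightarrow> bool" where
  "cpc_adwords I \<longleftrightarrow>
     prob_space (prob_sp I) \<and>
     (\<forall>i < num_adv I. 0 \<le> budget I i) \<and>
     (\<forall>i < num_adv I. \<forall>k < num_kw I. 0 \<le> valuation I i k) \<and>
     (\<forall>t < horizon I. keyword I t \<in> measurable (prob_sp I) (count_space {..<num_kw I})) \<and>
     (\<forall>t < horizon I. \<forall>i < num_adv I. \<forall>k < num_kw I.
        click_prob I t i k \<in> borel_measurable (prob_sp I) \<and>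
        (\<forall>\<omega> \<in> space (prob_sp I). click_prob I t i k \<omega> \<in> {0..1})) \<and>
     (\<forall>t < horizon I. \<forall>i < num_adv I. Measurable.pred (prob_sp I) (click I t i)) \<and>
     clicks_cond_indep I"

definition assignments :: "('w, 'z) adwords_scheme \<Rightarrow> nat set set" where
  "assignments I = {A. A \<subseteq> {..<num_adv I} \<and> card A \<le> capacity I}"

text \<open>
  A decision rule maps the period, the outcome and the list of past pairs (assigned set, set of
  clicked assigned advertisers) to the set to be assigned. It is an adaptive policy if the outcome
  enters only through the exogenous information available in that period.
\<close>

type_synonym 'w rule = "nat \<Rightarrow> 'w \<Rightarrow> (nat set \<times> nat set) list \<Rightarrow> nat set"

definition adaptive_policy :: "('w, 'z) adwords_scheme \<Rightarrow> 'w rule \<Rightarrow> bool" where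
  "adaptive_policy I \<pi> \<longleftrightarrow>
     (\<forall>t < horizon I. \<forall>h.
        (\<lambda>\<omega>. \<pi> t \<omega> h) \<in> measurable (exo_info I (Suc t)) (count_space (assignments I)))"

primrec history ::
  "('w, 'z) adwords_scheme \<Rightarrow> 'w rule \<Rightarrow> nat \<Rightarrow> 'w \<Rightarrow> (nat set \<times> nat set) list" where
  "history I \<pi> 0 \<omega> = []"
| "history I \<pi> (Suc t) \<omega> =
     (let h = history I \<pi> t \<omega>; A = \<pi> t \<omega> h in h @ [(A, {i \<in> A. click I t i \<omega>})])"

definition assigned :: "('w, 'z) adwords_scheme \<Rightarrow> 'w rule \<Rightarrow> nat \<Rightarrow> 'w \<Rightarrow> nat set" where
  "assigned I \<pi> t \<omega> = \<pi> t \<omega> (history I \<pi> t \<omega>)"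

definition charge ::
  "('w, 'z) adwords_scheme \<Rightarrow> 'w rule \<Rightarrow> nat \<Rightarrow> nat \<Rightarrow> real \<Rightarrow> 'w \<Rightarrow> real" where
  "charge I \<pi> t i b \<omega> =
     (if i \<in> assigned I \<pi> t \<omega> \<and> click I t i \<omega> then min (current_value I t i \<omega>) b else 0)"

primrec remaining :: "('w, 'z) adwords_scheme \<Rightarrow> 'w rule \<Rightarrow> nat \<Rightarrow> nat \<Rightarrow> 'w \<Rightarrow> real" where
  "remaining I \<pi> 0 i \<omega> = budget I i"
| "remaining I \<pi> (Suc t) i \<omega> =
     remaining I \<pi> t i \<omega> - charge I \<pi> t i (remaining I \<pi> t i \<omega>) \<omega>"

definition payment :: "('w, 'z) adwords_scheme \<Rightarrow> 'w rule \<Rightarrow> nat \<Rightarrow> nat \<Rightarrow> 'w \<Rightarrow> real" where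
  "payment I \<pi> t i \<omega> = charge I \<pi> t i (remaining I \<pi> t i \<omega>) \<omega>"

definition revenue :: "('w, 'z) adwords_scheme \<Rightarrow> 'w rule \<Rightarrow> 'w \<Rightarrow> real" where
  "revenue I \<pi> \<omega> = (\<Sum>i < num_adv I. min (budget I i) (\<Sum>t < horizon I. payment I \<pi> t i \<omega>))"

definition expected_revenue :: "('w, 'z) adwords_scheme \<Rightarrow> 'w rule \<Rightarrow> real" where
  "expected_revenue I \<pi> = (\<integral>\<omega>. revenue I \<pi> \<omega> \<partial>prob_sp I)"

definition optimal_revenue :: "('w, 'z) adwords_scheme \<Rightarrow> real" where
  "optimal_revenue I = (SUP \<pi> \<in> {\<pi>. adaptive_policy I \<pi>}. expected_revenue I \<pi>)"

text \<open>Expected payment collected in period \<open>t\<close> if \<open>A\<close> is assigned and \<open>\<pi>\<close> was followed before.\<close>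

definition period_value :: "('w, 'z) adwords_scheme \<Rightarrow> 'w rule \<Rightarrow> nat \<Rightarrow> 'w \<Rightarrow> nat set \<Rightarrow> real" where
  "period_value I \<pi> t \<omega> A =
     (\<Sum>i\<in>A. current_prob I t i \<omega> * min (current_value I t i \<omega>) (remaining I \<pi> t i \<omega>))"

definition myopic_policy :: "('w, 'z) adwords_scheme \<Rightarrow> 'w rule \<Rightarrow> bool" where
  "myopic_policy I \<pi> \<longleftrightarrow>
     adaptive_policy I \<pi> \<and>
     (\<forall>t < horizon I. \<forall>\<omega> \<in> space (prob_sp I). \<forall>A \<in> assignments I.
        period_value I \<pi> t \<omega> A \<le> period_value I \<pi> t \<omega> (assigned I \<pi> t \<omega>))"

text \<open>The supremum in \<^const>\<open>optimal_revenue\<close> is over a nonempty set that is bounded above.\<close>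

lemma adaptive_policy_empty: "adaptive_policy I (\<lambda>t \<omega> h. {})"
  by (simp add: adaptive_policy_def assignments_def)

lemma expected_revenue_le:
  assumes "cpc_adwords I"
  shows "expected_revenue I \<pi> \<le> (\<Sum>i < num_adv I. budget I i)"
proof (cases "integrable (prob_sp I) (revenue I \<pi>)")
  case True
  interpret prob_space "prob_sp I"
    using assms by (simp add: cpc_adwords_def)
  have "revenue I \<pi> \<omega> \<le> (\<Sum>i < num_adv I. budget I i)" for \<omega>
    unfolding revenue_def by (rule sum_mono) simp
  then show ?thesis
    unfolding expected_revenue_def using True by (intro integral_le_const) auto
next
  case False
  have "0 \<le> (\<Sum>i < num_adv I. budget I i)"
    using assms by (auto simp: cpc_adwords_def intro!: sum_nonneg)
  then show ?thesis
    using False by (simp add: expected_revenue_def not_integrable_integral_eq)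
qed

lemma bdd_above_expected_revenue:
  "cpc_adwords I \<Longrightarrow> bdd_above (expected_revenue I ` {\<pi>. adaptive_policy I \<pi>})"
  by (rule bdd_aboveI2) (rule expected_revenue_le)

end

theory Submission
  imports Defs
begin

text \<open>
  Run an arbitrary adaptive policy \<open>\<pi>\<close> and the myopic policy \<open>\<mu>\<close> on the same outcome, so that both see
  the same keywords and, for an advertiser whom both assign, the same click. Let \<open>b\<^sub>t\<close> and \<open>r\<^sub>t\<close> be the
  remaining budgets of an advertiser under \<open>\<mu>\<close> and \<open>\<pi>\<close>. Consider the fictitious payment
  \<open>min v b\<^sub>t\<close> that a click on an advertiser assigned by \<open>\<pi>\<close> would yield if his budget were the one that
  \<open>\<mu>\<close> has left him.

  On every outcome the fictitious payments before period \<open>t\<close> add up to at least \<open>b\<^sub>t - r\<^sub>t\<close>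
  (\<open>remaining_gap\<close>). The only critical step is a payment by an advertiser in the run of \<open>\<pi>\<close>. If
  \<open>v \<le> b\<^sub>t\<close>, the fictitious payment \<open>v\<close> makes up for the decrease of \<open>r\<^sub>t\<close>; otherwise the fictitious
  payment is all of \<open>b\<^sub>t\<close>, which bounds every later gap because budgets never grow or become negative.
  At the horizon this says that the revenue of \<open>\<pi>\<close> is at most the sum of the fictitious payments plus
  the revenue of \<open>\<mu>\<close> (\<open>revenue_le_collected\<close>).

  The click in period \<open>t\<close> is independent of the past, on which \<open>b\<^sub>t\<close> and the set that \<open>\<pi>\<close> assigns
  depend, so the expected fictitious payment in period \<open>t\<close> is the expected value, for the budgets left
  by \<open>\<mu>\<close>, of the set that \<open>\<pi>\<close> assigns (\<open>integral_sum_collected\<close>). The set assigned by \<open>\<mu>\<close> maximizes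
  this value pointwise, and its expected value is what \<open>\<mu>\<close> collects in period \<open>t\<close>. Hence the fictitious
  payments have expected sum at most the expected revenue of \<open>\<mu>\<close>, which gives the factor 2.

  The independence is used in elementary form: there are finitely many click patterns, and once the
  pattern is fixed, everything is a function of the exogenous processes alone. By the assumption on
  conditional probabilities, expectations become expectations of finite sums over patterns weighted by
  products of click probabilities (\<open>integral_click_pattern\<close>), and in such sums a single Bernoulli factor
  can be summed out (\<open>bernoulli_pattern_sum\<close>).
\<close>

section \<open>Finite sums and integrals\<close>

lemma sum_Pow_split:
  fixes f :: "'a set \<Rightarrow> real"
  assumes "finite D" and "d \<in> D"
  shows "(\<Sum>S\<in>Pow D. f S) = (\<Sum>S\<in>Pow (D - {d}). f S + f (insert d S))"
proof -
  have D: "D = insert d (D - {d})"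
    using assms by auto
  have inj: "inj_on (insert d) (Pow (D - {d}))"
    by (auto simp: inj_on_def)
  have "(\<Sum>S\<in>Pow D. f S) = (\<Sum>S\<in>Pow (D - {d}) \<union> insert d ` Pow (D - {d}). f S)"
    by (subst D, subst Pow_insert) simp
  also have "\<dots> = (\<Sum>S\<in>Pow (D - {d}). f S) + (\<Sum>S\<in>insert d ` Pow (D - {d}). f S)"
    using assms by (intro sum.union_disjoint) auto
  finally show ?thesis
    by (simp add: sum.reindex[OF inj] sum.distrib)
qed

text \<open>
  In a family of independent Bernoulli trials with success set \<open>S\<close>, the success of trial \<open>d\<close> can be
  replaced by its probability in the expectation of a product with a quantity that does not depend
  on that trial.
\<close>

lemma bernoulli_pattern_sum:
  fixes p :: "'a \<Rightarrow> real" and g :: "'a set \<Rightarrow> real"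
  assumes "finite D" and "d \<in> D"
    and g: "\<And>S. S \<subseteq> D - {d} \<Longrightarrow> g (insert d S) = g S"
  shows "(\<Sum>S\<in>Pow D. (\<Prod>e\<in>D. if e \<in> S then p e else 1 - p e) * (of_bool (d \<in> S) * g S)) =
         (\<Sum>S\<in>Pow D. (\<Prod>e\<in>D. if e \<in> S then p e else 1 - p e) * (p d * g S))"
    (is "(\<Sum>S\<in>_. ?q S * _) = _")
proof -
  let ?r = "\<lambda>S. \<Prod>e\<in>D - {d}. if e \<in> S then p e else 1 - p e"
  have q0: "?q S = (1 - p d) * ?r S" if "S \<subseteq> D - {d}" for S
    using that assms by (subst prod.remove[of D d]) auto
  have "?q (insert d S) = p d * ?r (insert d S)" for S
    using assms by (subst prod.remove[of D d]) auto
  moreover have "?r (insert d S) = ?r S" for S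
    by (rule prod.cong) auto
  ultimately have q1: "?q (insert d S) = p d * ?r S" for S
    by simp
  show ?thesis
    unfolding sum_Pow_split[OF assms(1,2)]
  proof (rule sum.cong[OF refl])
    fix S assume "S \<in> Pow (D - {d})"
    then have S: "S \<subseteq> D - {d}" by simp
    then have "d \<notin> S" by auto
    then show "?q S * (of_bool (d \<in> S) * g S) +
          ?q (insert d S) * (of_bool (d \<in> insert d S) * g (insert d S)) =
        ?q S * (p d * g S) + ?q (insert d S) * (p d * g (insert d S))"
      unfolding q0[OF S] q1 g[OF S] by (simp add: algebra_simps)
  qed
qed

lemma integral_double_sum:
  fixes f :: "'a \<Rightarrow> 'b \<Rightarrow> 'c \<Rightarrow> real"
  assumes "\<And>a b. a \<in> A \<Longrightarrow> b \<in> B \<Longrightarrow> integrable M (f a b)"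
  shows "integrable M (\<lambda>x. \<Sum>a\<in>A. \<Sum>b\<in>B. f a b x)"
    and "(\<integral>x. (\<Sum>a\<in>A. \<Sum>b\<in>B. f a b x) \<partial>M) = (\<Sum>a\<in>A. \<Sum>b\<in>B. \<integral>x. f a b x \<partial>M)"
proof -
  have inner: "integrable M (\<lambda>x. \<Sum>b\<in>B. f a b x)" if "a \<in> A" for a
    using assms that by (intro Bochner_Integration.integrable_sum) auto
  show "integrable M (\<lambda>x. \<Sum>a\<in>A. \<Sum>b\<in>B. f a b x)"
    by (rule Bochner_Integration.integrable_sum) (rule inner)
  have "(\<integral>x. (\<Sum>a\<in>A. \<Sum>b\<in>B. f a b x) \<partial>M) = (\<Sum>a\<in>A. \<integral>x. (\<Sum>b\<in>B. f a b x) \<partial>M)"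
    by (rule Bochner_Integration.integral_sum) (rule inner)
  also have "\<dots> = (\<Sum>a\<in>A. \<Sum>b\<in>B. \<integral>x. f a b x \<partial>M)"
    using assms by (intro sum.cong refl Bochner_Integration.integral_sum) auto
  finally show "(\<integral>x. (\<Sum>a\<in>A. \<Sum>b\<in>B. f a b x) \<partial>M) = (\<Sum>a\<in>A. \<Sum>b\<in>B. \<integral>x. f a b x \<partial>M)" .
qed

section \<open>Prescribed click patterns\<close>

text \<open>All pairs (period, advertiser).\<close>

definition slots :: "('w, 'z) adwords_scheme \<Rightarrow> (nat \<times> nat) set" where
  "slots I = {..<horizon I} \<times> {..<num_adv I}"

text \<open>
  The realized clicks of all advertisers, assigned or not, as a subset of the slots.
\<close>

definition click_pattern :: "('w, 'z) adwords_scheme \<Rightarrow> 'w \<Rightarrow> (nat \<times> nat) set" where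
  "click_pattern I \<omega> = {(s, j) \<in> slots I. click I s j \<omega>}"

text \<open>
  The instance in which the clicks are prescribed by \<open>S\<close> and no longer depend on the outcome. In
  general it violates \<^const>\<open>cpc_adwords\<close>; it serves to express what a policy would do if the
  click pattern were \<open>S\<close>.
\<close>

definition with_clicks ::
  "('w, 'z) adwords_scheme \<Rightarrow> (nat \<times> nat) set \<Rightarrow> ('w, 'z) adwords_scheme" where
  "with_clicks I S = I\<lparr>click := \<lambda>s j _. (s, j) \<in> S\<rparr>"

text \<open>
  The conditional probability of the click pattern \<open>S\<close> given the exogenous processes, for
  \<open>S \<subseteq> slots I\<close>.
\<close>

definition pattern_prob ::
  "('w, 'z) adwords_scheme \<Rightarrow> (nat \<times> nat) set \<Rightarrow> 'w \<Rightarrow> real" where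
  "pattern_prob I S \<omega> =
     (\<Prod>d\<in>slots I. if d \<in> S then current_prob I (fst d) (snd d) \<omega>
                   else 1 - current_prob I (fst d) (snd d) \<omega>)"

text \<open>
  The fictitious payment of advertiser \<open>i\<close> in period \<open>t\<close>: the assignment is made by \<open>\<rho>\<close>, while the
  remaining budget is the one left by \<open>\<mu>\<close>. For \<open>\<rho> = \<mu>\<close> it is the actual payment.
\<close>

definition collected ::
  "('w, 'z) adwords_scheme \<Rightarrow> 'w rule \<Rightarrow> 'w rule \<Rightarrow> nat \<Rightarrow> nat \<Rightarrow> 'w \<Rightarrow> real" where
  "collected I \<rho> \<mu> t i \<omega> = charge I \<rho> t i (remaining I \<mu> t i \<omega>) \<omega>"

lemma finite_slots [simp]: "finite (slots I)"
  by (simp add: slots_def)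

lemma click_pattern_subset: "click_pattern I \<omega> \<subseteq> slots I"
  by (auto simp: click_pattern_def)

lemma with_clicks_simps [simp]:
  "prob_sp (with_clicks I S) = prob_sp I"
  "num_adv (with_clicks I S) = num_adv I"
  "num_kw (with_clicks I S) = num_kw I"
  "horizon (with_clicks I S) = horizon I"
  "capacity (with_clicks I S) = capacity I"
  "budget (with_clicks I S) = budget I"
  "valuation (with_clicks I S) = valuation I"
  "keyword (with_clicks I S) = keyword I"
  "click_prob (with_clicks I S) = click_prob I"
  "click (with_clicks I S) s j \<omega> \<longleftrightarrow> (s, j) \<in> S"
  by (simp_all add: with_clicks_def)

lemma with_clicks_exo [simp]:
  "current_value (with_clicks I S) = current_value I"
  "current_prob (with_clicks I S) = current_prob I"
  by (simp_all add: fun_eq_iff current_value_def current_prob_def)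

text \<open>
  Histories, assigned sets and remaining budgets at the beginning of period \<open>t\<close> depend on the clicks
  of earlier periods only.
\<close>

lemma history_with_clicks:
  assumes "\<And>s h. s < t \<Longrightarrow> \<rho> s \<omega> h \<subseteq> {..<num_adv I}"
    and "\<And>s j. s < t \<Longrightarrow> j < num_adv I \<Longrightarrow> click I s j \<omega> \<longleftrightarrow> (s, j) \<in> S"
  shows "history I \<rho> t \<omega> = history (with_clicks I S) \<rho> t \<omega>"
  using assms
proof (induction t)
  case (Suc t)
  let ?A = "\<rho> t \<omega> (history I \<rho> t \<omega>)"
  have "history I \<rho> t \<omega> = history (with_clicks I S) \<rho> t \<omega>"
    using Suc.prems by (intro Suc.IH) auto
  moreover have "{i \<in> ?A. click I t i \<omega>} = {i \<in> ?A. (t, i) \<in> S}"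
    using Suc.prems(1)[of t "history I \<rho> t \<omega>"] Suc.prems(2)[of t] by auto
  ultimately show ?case
    by (simp add: Let_def)
qed simp

lemma assigned_with_clicks:
  assumes "\<And>s h. s < t \<Longrightarrow> \<rho> s \<omega> h \<subseteq> {..<num_adv I}"
    and "\<And>s j. s < t \<Longrightarrow> j < num_adv I \<Longrightarrow> click I s j \<omega> \<longleftrightarrow> (s, j) \<in> S"
  shows "assigned I \<rho> t \<omega> = assigned (with_clicks I S) \<rho> t \<omega>"
  unfolding assigned_def by (subst history_with_clicks[of t \<rho> \<omega> I S]) (use assms in auto)

lemma remaining_with_clicks:
  assumes "i < num_adv I"
    and "\<And>s h. s < t \<Longrightarrow> \<rho> s \<omega> h \<subseteq> {..<num_adv I}"
    and "\<And>s j. s < t \<Longrightarrow> j < num_adv I \<Longrightarrow> click I s j \<omega> \<longleftrightarrow> (s, j) \<in> S"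
  shows "remaining I \<rho> t i \<omega> = remaining (with_clicks I S) \<rho> t i \<omega>"
  using assms
proof (induction t)
  case (Suc t)
  have "remaining I \<rho> t i \<omega> = remaining (with_clicks I S) \<rho> t i \<omega>"
    using Suc.prems by (intro Suc.IH) auto
  moreover have "assigned I \<rho> t \<omega> = assigned (with_clicks I S) \<rho> t \<omega>"
    using Suc.prems by (intro assigned_with_clicks) auto
  ultimately show ?case
    using Suc.prems by (simp add: charge_def)
qed simp

lemma with_clicks_twice [simp]: "with_clicks (with_clicks I S) S' = with_clicks I S'"
  by (simp add: with_clicks_def)

section \<open>Comparison of two policies on one outcome\<close>

lemma collected_self: "collected J \<rho> \<rho> t i \<omega> = payment J \<rho> t i \<omega>"
  by (simp add: collected_def payment_def)

lemma remaining_bounds: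
  assumes "0 \<le> budget J i" and "\<And>s. s < t \<Longrightarrow> 0 \<le> current_value J s i \<omega>"
  shows "0 \<le> remaining J \<mu> t i \<omega> \<and> remaining J \<mu> t i \<omega> \<le> budget J i"
  using assms(2)
proof (induction t)
  case (Suc t)
  have "0 \<le> remaining J \<mu> t i \<omega> \<and> remaining J \<mu> t i \<omega> \<le> budget J i"
    using Suc by simp
  moreover have "0 \<le> current_value J t i \<omega>"
    using Suc.prems by simp
  ultimately show ?case
    by (auto simp: charge_def)
qed (use assms in simp)

lemma collected_bounds:
  assumes "0 \<le> budget J i" and "\<And>s. s \<le> t \<Longrightarrow> 0 \<le> current_value J s i \<omega>"
  shows "0 \<le> collected J \<rho> \<mu> t i \<omega> \<and> collected J \<rho> \<mu> t i \<omega> \<le> budget J i"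
proof -
  have "0 \<le> current_value J t i \<omega>"
    using assms by simp
  then show ?thesis
    using remaining_bounds[of J i t \<omega> \<mu>] assms by (auto simp: collected_def charge_def)
qed

lemma sum_payment: "(\<Sum>s<t. payment J \<rho> s i \<omega>) = budget J i - remaining J \<rho> t i \<omega>"
  by (induction t) (simp_all add: payment_def)

text \<open>
  The lead of \<open>\<mu>\<close> over \<open>\<pi>\<close> in remaining budget is covered by the fictitious payments so far.
\<close>

lemma remaining_gap:
  assumes "0 \<le> budget J i" and "\<And>s. s < t \<Longrightarrow> 0 \<le> current_value J s i \<omega>"
  shows "remaining J \<mu> t i \<omega> - remaining J \<pi> t i \<omega> \<le> (\<Sum>s<t. collected J \<pi> \<mu> s i \<omega>)"
  using assms(2)
proof (induction t)
  case (Suc t)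
  let ?b = "remaining J \<mu> t i \<omega>" and ?r = "remaining J \<pi> t i \<omega>"
  have v: "0 \<le> current_value J t i \<omega>"
    using Suc.prems by simp
  have b: "0 \<le> ?b" and r: "0 \<le> ?r"
    using remaining_bounds[of J i t \<omega>] assms(1) Suc.prems by simp_all
  have nonneg: "0 \<le> (\<Sum>s<t. collected J \<pi> \<mu> s i \<omega>)"
    using collected_bounds[of J i _ \<omega> \<pi> \<mu>] assms(1) Suc.prems by (intro sum_nonneg) simp
  have "?b - ?r \<le> (\<Sum>s<t. collected J \<pi> \<mu> s i \<omega>)"
    using Suc by simp
  moreover have "remaining J \<mu> (Suc t) i \<omega> \<le> ?b"
    using v b by (auto simp: charge_def)
  \<comment> \<open>After a click on \<open>i\<close> with \<open>?b < v\<close>, the new summand \<open>?b\<close> alone covers the gap; the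
    nonnegativity of the other summands is needed there.\<close>
  ultimately show ?case
    using v r nonneg
    by (cases "i \<in> assigned J \<pi> t \<omega> \<and> click J t i \<omega>")
       (auto simp: collected_def charge_def[of J \<pi>] min_def)
qed simp

lemma revenue_eq_spent:
  assumes "\<And>i. i < num_adv J \<Longrightarrow> 0 \<le> budget J i"
    and "\<And>s i. s < horizon J \<Longrightarrow> i < num_adv J \<Longrightarrow> 0 \<le> current_value J s i \<omega>"
  shows "revenue J \<rho> \<omega> = (\<Sum>i<num_adv J. budget J i - remaining J \<rho> (horizon J) i \<omega>)"
  unfolding revenue_def sum_payment
proof (rule sum.cong[OF refl])
  fix i assume "i \<in> {..<num_adv J}"
  then show "min (budget J i) (budget J i - remaining J \<rho> (horizon J) i \<omega>) =
      budget J i - remaining J \<rho> (horizon J) i \<omega>"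
    using remaining_bounds[of J i "horizon J" \<omega> \<rho>] assms by simp
qed

lemma revenue_le_collected:
  assumes "\<And>i. i < num_adv J \<Longrightarrow> 0 \<le> budget J i"
    and "\<And>s i. s < horizon J \<Longrightarrow> i < num_adv J \<Longrightarrow> 0 \<le> current_value J s i \<omega>"
  shows "revenue J \<pi> \<omega> \<le>
    (\<Sum>i<num_adv J. \<Sum>t<horizon J. collected J \<pi> \<mu> t i \<omega>) + revenue J \<mu> \<omega>"
proof -
  have "(\<Sum>i<num_adv J. budget J i - remaining J \<pi> (horizon J) i \<omega>) \<le>
      (\<Sum>i<num_adv J. (\<Sum>t<horizon J. collected J \<pi> \<mu> t i \<omega>) +
        (budget J i - remaining J \<mu> (horizon J) i \<omega>))"
  proof (rule sum_mono)
    fix i assume "i \<in> {..<num_adv J}"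
    then show "budget J i - remaining J \<pi> (horizon J) i \<omega> \<le>
        (\<Sum>t<horizon J. collected J \<pi> \<mu> t i \<omega>) + (budget J i - remaining J \<mu> (horizon J) i \<omega>)"
      using remaining_gap[of J i "horizon J" \<omega> \<mu> \<pi>] assms by simp
  qed
  then show ?thesis
    using assms by (simp add: revenue_eq_spent sum.distrib)
qed

section \<open>Measurability with respect to the exogenous processes\<close>

text \<open>Below, \<open>F\<close> is the \<open>\<sigma>\<close>-algebra of the whole path of the exogenous processes.\<close>

locale cpc_instance =
  fixes I :: "('w, 'z) adwords_scheme"
  assumes cpc: "cpc_adwords I"
begin

abbreviation "M \<equiv> prob_sp I"
abbreviation "F \<equiv> exo_info I (horizon I)"

sublocale prob_space M
  using cpc by (simp add: cpc_adwords_def)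

lemma budget_nonneg: "i < num_adv I \<Longrightarrow> 0 \<le> budget I i"
  using cpc by (simp add: cpc_adwords_def)

lemma keyword_less: "t < horizon I \<Longrightarrow> \<omega> \<in> space M \<Longrightarrow> keyword I t \<omega> < num_kw I"
  using cpc measurable_space[of "keyword I t" M "count_space {..<num_kw I}" \<omega>]
  by (simp add: cpc_adwords_def)

lemma current_value_nonneg:
  "t < horizon I \<Longrightarrow> i < num_adv I \<Longrightarrow> \<omega> \<in> space M \<Longrightarrow> 0 \<le> current_value I t i \<omega>"
  using cpc keyword_less by (simp add: cpc_adwords_def current_value_def)

lemma current_prob_bounds:
  "t < horizon I \<Longrightarrow> i < num_adv I \<Longrightarrow> \<omega> \<in> space M \<Longrightarrow>
    0 \<le> current_prob I t i \<omega> \<and> current_prob I t i \<omega> \<le> 1"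
  using cpc keyword_less by (simp add: cpc_adwords_def current_prob_def)

lemma space_exo_info [simp]: "space (exo_info I n) = space M"
  by (simp add: exo_info_def space_measure_of_conv)

lemma sets_exo_info:
  "sets (exo_info I n) = sigma_sets (space M)
     ({keyword I s -` A \<inter> space M |s A. s < n} \<union>
      {click_prob I s i k -` A \<inter> space M |s i k A.
         s < n \<and> i < num_adv I \<and> k < num_kw I \<and> A \<in> sets borel})"
  unfolding exo_info_def by (subst sets_measure_of) auto

lemma subalgebra_exo_info: "subalgebra M F"
unfolding subalgebra_def
proof (intro conjI)
  have "keyword I s -` A \<inter> space M \<in> sets M" if "s < horizon I" for s A
  proof -
    have "keyword I s \<in> measurable M (count_space {..<num_kw I})"
      using cpc that by (simp add: cpc_adwords_def)
    then have "keyword I s -` (A \<inter> {..<num_kw I}) \<inter> space M \<in> sets M"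
      by (rule measurable_sets) simp
    moreover have "keyword I s -` (A \<inter> {..<num_kw I}) \<inter> space M = keyword I s -` A \<inter> space M"
      using keyword_less[OF that] by auto
    ultimately show ?thesis by simp
  qed
  moreover have "click_prob I s i k -` A \<inter> space M \<in> sets M"
    if "s < horizon I" "i < num_adv I" "k < num_kw I" "A \<in> sets borel" for s i k A
    using cpc that by (auto simp: cpc_adwords_def intro!: measurable_sets[of _ M borel])
  ultimately show "sets F \<subseteq> sets M"
    unfolding sets_exo_info by (intro sets.sigma_sets_subset) auto
qed simp

lemma subalgebra_exo_info_earlier:
  assumes "n \<le> horizon I"
  shows "subalgebra F (exo_info I n)"
unfolding subalgebra_def
proof (intro conjI)
  show "sets (exo_info I n) \<subseteq> sets F"
    unfolding sets_exo_info
  proof (intro sigma_sets_mono' Un_mono subsetI; clarify)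
    fix s A assume "s < n"
    with assms have "s < horizon I" by simp
    then show "\<exists>s' A'. keyword I s -` A \<inter> space M = keyword I s' -` A' \<inter> space M \<and> s' < horizon I"
      by blast
  next
    fix s i k and A :: "real set" assume "s < n" "i < num_adv I" "k < num_kw I" "A \<in> sets borel"
    with assms have "s < horizon I" "i < num_adv I" "k < num_kw I" "A \<in> sets borel" by simp_all
    then show "\<exists>s' i' k' A'. click_prob I s i k -` A \<inter> space M = click_prob I s' i' k' -` A' \<inter> space M \<and>
        s' < horizon I \<and> i' < num_adv I \<and> k' < num_kw I \<and> A' \<in> sets borel"
      by blast
  qed
qed simp

lemma measurable_keyword:
  assumes "t < horizon I"
  shows "keyword I t \<in> measurable F (count_space {..<num_kw I})"
proof (rule measurableI)
  fix A
  have "keyword I t -` A \<inter> space M \<in> sets F"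
    unfolding sets_exo_info using assms by (intro sigma_sets.Basic) blast
  then show "keyword I t -` A \<inter> space F \<in> sets F" by simp
qed (use keyword_less[OF assms] in auto)

lemma measurable_current_value [measurable]:
  assumes "t < horizon I"
  shows "current_value I t i \<in> borel_measurable F"
  unfolding current_value_def
  by (rule measurable_compose[OF measurable_keyword[OF assms]]) simp

lemma measurable_current_prob [measurable]:
  assumes "t < horizon I" and "i < num_adv I"
  shows "current_prob I t i \<in> borel_measurable F"
  unfolding current_prob_def
proof (rule measurable_compose_countable'[OF _ measurable_keyword[OF assms(1)]])
  fix k assume k: "k \<in> {..<num_kw I}"
  show "click_prob I t i k \<in> borel_measurable F"
  proof (rule measurableI)
    fix A :: "real set" assume "A \<in> sets borel"
    then have "click_prob I t i k -` A \<inter> space M \<in> sets F"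
      unfolding sets_exo_info using assms k by (intro sigma_sets.Basic) blast
    then show "click_prob I t i k -` A \<inter> space F \<in> sets F" by simp
  qed simp
qed simp

lemma adaptive_assigns:
  assumes "adaptive_policy I \<rho>" and "t < horizon I" and "\<omega> \<in> space M"
  shows "\<rho> t \<omega> h \<in> assignments I"
  using assms measurable_space[of "\<lambda>\<omega>. \<rho> t \<omega> h" "exo_info I (Suc t)" "count_space (assignments I)" \<omega>]
  by (simp add: adaptive_policy_def)

lemma adaptive_subset:
  assumes "adaptive_policy I \<rho>" and "t < horizon I" and "\<omega> \<in> space M"
  shows "\<rho> t \<omega> h \<subseteq> {..<num_adv I}"
  using adaptive_assigns[OF assms] by (simp add: assignments_def)

lemma measurable_rule:
  assumes "adaptive_policy I \<rho>" and "t < horizon I"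
  shows "(\<lambda>\<omega>. \<rho> t \<omega> h) \<in> measurable F (count_space (assignments I))"
  using assms subalgebra_exo_info_earlier[of "Suc t"]
  by (auto simp: adaptive_policy_def intro: measurable_from_subalg)

text \<open>
  All histories take values in a countable set, so that a policy applied to a measurable history is
  again measurable.
\<close>

lemma countable_histories:
  "countable (lists (Pow {..<num_adv I} \<times> Pow {..<num_adv I}))"
  by (intro countable_lists countable_finite) auto

lemma measurable_history:
  assumes "adaptive_policy I \<rho>" and "t \<le> horizon I"
  shows "history (with_clicks I S) \<rho> t
    \<in> measurable F (count_space (lists (Pow {..<num_adv I} \<times> Pow {..<num_adv I})))"
  using assms(2)
proof (induction t)
  case (Suc t)
  let ?L = "lists (Pow {..<num_adv I} \<times> Pow {..<num_adv I})"
  have "(\<lambda>\<omega>. (\<lambda>A. h @ [(A, {i \<in> A. (t, i) \<in> S})]) (\<rho> t \<omega> h)) \<in> measurable F (count_space ?L)"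
    if h: "h \<in> ?L" for h
  proof (rule measurable_compose[OF measurable_rule[OF assms(1)]])
    have "h @ [(A, {i \<in> A. (t, i) \<in> S})] \<in> ?L" if "A \<in> assignments I" for A
      unfolding append_in_lists_conv using h that by (intro conjI) (auto simp: assignments_def)
    then show "(\<lambda>A. h @ [(A, {i \<in> A. (t, i) \<in> S})]) \<in>
        measurable (count_space (assignments I)) (count_space ?L)"
      by simp
  qed (use Suc.prems in simp)
  from measurable_compose_countable'[OF this Suc.IH countable_histories] Suc.prems
  have "(\<lambda>\<omega>. history (with_clicks I S) \<rho> (Suc t) \<omega>) \<in> measurable F (count_space ?L)"
    by (simp add: Let_def)
  then show ?case .
next
  case 0
  have "(\<lambda>\<omega>. history (with_clicks I S) \<rho> 0 \<omega>) \<in>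
      measurable F (count_space (lists (Pow {..<num_adv I} \<times> Pow {..<num_adv I})))"
    by simp
  then show ?case .
qed

lemma measurable_assigned:
  assumes "adaptive_policy I \<rho>" and "t < horizon I"
  shows "assigned (with_clicks I S) \<rho> t \<in> measurable F (count_space (assignments I))"
  unfolding assigned_def
  by (rule measurable_compose_countable'[OF measurable_rule[OF assms]
        measurable_history[OF assms(1)] countable_histories]) (use assms in simp)

lemma measurable_charge:
  assumes "adaptive_policy I \<rho>" and "t < horizon I" and [measurable]: "b \<in> borel_measurable F"
  shows "(\<lambda>\<omega>. charge (with_clicks I S) \<rho> t i (b \<omega>) \<omega>) \<in> borel_measurable F"
proof -
  have [measurable]: "Measurable.pred F (\<lambda>\<omega>. i \<in> assigned (with_clicks I S) \<rho> t \<omega>)"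
    by (rule measurable_compose[OF measurable_assigned[OF assms(1,2)]]) simp
  note [measurable] = measurable_current_value[OF assms(2)]
  show ?thesis unfolding charge_def with_clicks_exo with_clicks_simps by measurable
qed

lemma measurable_remaining:
  assumes "adaptive_policy I \<mu>" and "t \<le> horizon I"
  shows "remaining (with_clicks I S) \<mu> t i \<in> borel_measurable F"
  using assms(2)
proof (induction t)
  case (Suc t)
  then have t: "t < horizon I" and b: "remaining (with_clicks I S) \<mu> t i \<in> borel_measurable F"
    by simp_all
  have "(\<lambda>\<omega>. remaining (with_clicks I S) \<mu> (Suc t) i \<omega>) \<in> borel_measurable F"
    unfolding remaining.simps
    by (rule borel_measurable_diff[OF b measurable_charge[OF assms(1) t b]])
  then show ?case .
next
  case 0
  have "(\<lambda>\<omega>. remaining (with_clicks I S) \<mu> 0 i \<omega>) \<in> borel_measurable F"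
    by simp
  then show ?case .
qed

section \<open>Averaging over the click patterns\<close>

lemma click_pattern_sets [measurable]: "{\<omega> \<in> space M. click_pattern I \<omega> = S} \<in> sets M"
proof (cases "S \<subseteq> slots I")
  case True
  have [measurable]: "Measurable.pred M (click I s j)" if "s < horizon I" "j < num_adv I" for s j
    using cpc that by (simp add: cpc_adwords_def)
  have "{\<omega> \<in> space M. click_pattern I \<omega> = S} =
      {\<omega> \<in> space M. \<forall>s\<in>{..<horizon I}. \<forall>j\<in>{..<num_adv I}. click I s j \<omega> \<longleftrightarrow> (s, j) \<in> S}"
    using True by (auto simp: click_pattern_def slots_def)
  moreover have "\<dots> \<in> sets M"
    by (intro sets.sets_Collect_finite_All finite_lessThan) measurable
  ultimately show ?thesis by simp
next
  case False
  then have "click_pattern I \<omega> \<noteq> S" for \<omega>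
    using click_pattern_subset[of I \<omega>] by auto
  then show ?thesis by simp
qed

lemma measurable_pattern_prob: "pattern_prob I S \<in> borel_measurable F"
  unfolding pattern_prob_def
proof (rule borel_measurable_prod)
  fix d assume "d \<in> slots I"
  then have [measurable]: "current_prob I (fst d) (snd d) \<in> borel_measurable F"
    by (intro measurable_current_prob) (auto simp: slots_def)
  show "(\<lambda>\<omega>. if d \<in> S then current_prob I (fst d) (snd d) \<omega>
      else 1 - current_prob I (fst d) (snd d) \<omega>) \<in> borel_measurable F"
    by measurable
qed

lemma pattern_prob_bounds:
  assumes "\<omega> \<in> space M"
  shows "0 \<le> pattern_prob I S \<omega> \<and> pattern_prob I S \<omega> \<le> 1"
  unfolding pattern_prob_def
  using current_prob_bounds[OF _ _ assms]
  by (intro conjI prod_nonneg prod_le_1) (auto simp: slots_def)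

lemma cond_exp_click_pattern:
  assumes "S \<subseteq> slots I"
  shows "AE \<omega> in M. real_cond_exp M F (indicator {\<omega> \<in> space M. click_pattern I \<omega> = S}) \<omega> =
    pattern_prob I S \<omega>"
proof -
  have "{\<omega> \<in> space M. click_pattern I \<omega> = S} =
      {\<omega> \<in> space M. \<forall>t<horizon I. \<forall>i<num_adv I. click I t i \<omega> = ((t, i) \<in> S)}"
    using assms by (auto simp: click_pattern_def slots_def)
  moreover have "pattern_prob I S \<omega> = (\<Prod>t<horizon I. \<Prod>i<num_adv I.
      if (t, i) \<in> S then current_prob I t i \<omega> else 1 - current_prob I t i \<omega>)" for \<omega>
    by (simp add: pattern_prob_def slots_def prod.cartesian_product case_prod_beta)
  ultimately show ?thesis
    using cpc by (simp add: cpc_adwords_def clicks_cond_indep_def)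
qed

lemma measurable_exo: "f \<in> borel_measurable F \<Longrightarrow> f \<in> borel_measurable M"
  by (rule measurable_from_subalg[OF subalgebra_exo_info])

lemma integrable_bounded_exo:
  fixes f :: "'w \<Rightarrow> real"
  assumes "f \<in> borel_measurable F" and "\<And>\<omega>. \<omega> \<in> space M \<Longrightarrow> \<bar>f \<omega>\<bar> \<le> K"
  shows "integrable M f"
  using assms by (intro integrable_const_bound[of _ K] measurable_exo AE_I2) auto

lemma integral_indicator_click_pattern:
  fixes W :: "'w \<Rightarrow> real"
  assumes "S \<subseteq> slots I" and W: "W \<in> borel_measurable F"
    and K: "\<And>\<omega>. \<omega> \<in> space M \<Longrightarrow> \<bar>W \<omega>\<bar> \<le> K"
  defines "E \<equiv> {\<omega> \<in> space M. click_pattern I \<omega> = S}"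
  shows "integrable M (\<lambda>\<omega>. W \<omega> * indicator E \<omega>)"
    and "(\<integral>\<omega>. W \<omega> * indicator E \<omega> \<partial>M) = (\<integral>\<omega>. pattern_prob I S \<omega> * W \<omega> \<partial>M)"
proof -
  interpret finite_measure_subalgebra M F
    by unfold_locales (rule subalgebra_exo_info)
  have E [measurable]: "E \<in> sets M"
    unfolding E_def by measurable
  note [measurable] = measurable_exo[OF W] measurable_exo[OF measurable_pattern_prob]
  show int: "integrable M (\<lambda>\<omega>. W \<omega> * indicator E \<omega>)"
    using integrable_bounded_exo[OF W K] E by (rule integrable_real_mult_indicator[rotated])
  have "(\<integral>\<omega>. W \<omega> * indicator E \<omega> \<partial>M) = (\<integral>\<omega>. W \<omega> * real_cond_exp M F (indicator E) \<omega> \<partial>M)"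
    by (rule real_cond_exp_intg(2)[OF int W, symmetric]) measurable
  also have "\<dots> = (\<integral>\<omega>. pattern_prob I S \<omega> * W \<omega> \<partial>M)"
    using cond_exp_click_pattern[OF assms(1)] unfolding E_def[symmetric]
    by (intro integral_cong_AE) auto
  finally show "(\<integral>\<omega>. W \<omega> * indicator E \<omega> \<partial>M) = (\<integral>\<omega>. pattern_prob I S \<omega> * W \<omega> \<partial>M)" .
qed

text \<open>
  Conditioning on the exogenous processes: the click pattern is averaged out with the weights
  \<^const>\<open>pattern_prob\<close>.
\<close>

lemma integral_click_pattern:
  fixes W :: "(nat \<times> nat) set \<Rightarrow> 'w \<Rightarrow> real"
  assumes W: "\<And>S. W S \<in> borel_measurable F"
    and K: "\<And>S \<omega>. \<omega> \<in> space M \<Longrightarrow> \<bar>W S \<omega>\<bar> \<le> K"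
  shows "integrable M (\<lambda>\<omega>. W (click_pattern I \<omega>) \<omega>)"
    and "(\<integral>\<omega>. W (click_pattern I \<omega>) \<omega> \<partial>M) =
      (\<integral>\<omega>. (\<Sum>S\<in>Pow (slots I). pattern_prob I S \<omega> * W S \<omega>) \<partial>M)"
proof -
  let ?E = "\<lambda>S. {\<omega> \<in> space M. click_pattern I \<omega> = S}"
  have split: "W (click_pattern I \<omega>) \<omega> = (\<Sum>S\<in>Pow (slots I). W S \<omega> * indicator (?E S) \<omega>)"
    if "\<omega> \<in> space M" for \<omega>
  proof -
    have "(\<Sum>S\<in>Pow (slots I). W S \<omega> * indicator (?E S) \<omega>) =
        (\<Sum>S\<in>Pow (slots I). if S = click_pattern I \<omega> then W S \<omega> else 0)"
      using that by (intro sum.cong) (auto simp: indicator_def)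
    then show ?thesis
      using click_pattern_subset[of I \<omega>] by (simp add: sum.delta')
  qed
  have int: "integrable M (\<lambda>\<omega>. W S \<omega> * indicator (?E S) \<omega>)" if "S \<in> Pow (slots I)" for S
    using that W K by (intro integral_indicator_click_pattern) auto
  have "integrable M (\<lambda>\<omega>. \<Sum>S\<in>Pow (slots I). W S \<omega> * indicator (?E S) \<omega>)"
    by (rule Bochner_Integration.integrable_sum) (rule int)
  then show "integrable M (\<lambda>\<omega>. W (click_pattern I \<omega>) \<omega>)"
    by (subst Bochner_Integration.integrable_cong[OF refl split])
  have qW: "integrable M (\<lambda>\<omega>. pattern_prob I S \<omega> * W S \<omega>)" for S
  proof (rule integrable_bounded_exo)
    show "(\<lambda>\<omega>. pattern_prob I S \<omega> * W S \<omega>) \<in> borel_measurable F"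
      by (intro borel_measurable_times measurable_pattern_prob W)
    show "\<bar>pattern_prob I S \<omega> * W S \<omega>\<bar> \<le> 1 * K" if "\<omega> \<in> space M" for \<omega>
      unfolding abs_mult using pattern_prob_bounds[OF that] K[OF that] by (intro mult_mono) auto
  qed
  have "(\<integral>\<omega>. W (click_pattern I \<omega>) \<omega> \<partial>M) =
      (\<integral>\<omega>. (\<Sum>S\<in>Pow (slots I). W S \<omega> * indicator (?E S) \<omega>) \<partial>M)"
    by (rule Bochner_Integration.integral_cong) (simp_all add: split)
  also have "\<dots> = (\<Sum>S\<in>Pow (slots I). \<integral>\<omega>. W S \<omega> * indicator (?E S) \<omega> \<partial>M)"
    by (rule Bochner_Integration.integral_sum) (rule int)
  also have "\<dots> = (\<Sum>S\<in>Pow (slots I). \<integral>\<omega>. pattern_prob I S \<omega> * W S \<omega> \<partial>M)"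
    using W K by (intro sum.cong refl integral_indicator_click_pattern) auto
  also have "\<dots> = (\<integral>\<omega>. (\<Sum>S\<in>Pow (slots I). pattern_prob I S \<omega> * W S \<omega>) \<partial>M)"
    by (rule Bochner_Integration.integral_sum[symmetric]) (rule qW)
  finally show "(\<integral>\<omega>. W (click_pattern I \<omega>) \<omega> \<partial>M) =
      (\<integral>\<omega>. (\<Sum>S\<in>Pow (slots I). pattern_prob I S \<omega> * W S \<omega>) \<partial>M)" .
qed

text \<open>
  A click can be replaced by its probability in front of a quantity that depends on the exogenous
  processes and on the clicks in all other slots. This is the form in which the independence of the
  click from the past is used.
\<close>

lemma integral_click:
  fixes Z :: "(nat \<times> nat) set \<Rightarrow> 'w \<Rightarrow> real"
  assumes t: "t < horizon I" and i: "i < num_adv I"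
    and Z: "\<And>S. Z S \<in> borel_measurable F"
    and K: "\<And>S \<omega>. \<omega> \<in> space M \<Longrightarrow> \<bar>Z S \<omega>\<bar> \<le> K"
    and free: "\<And>S \<omega>. \<omega> \<in> space M \<Longrightarrow> Z (insert (t, i) S) \<omega> = Z S \<omega>"
  shows "integrable M (\<lambda>\<omega>. of_bool (click I t i \<omega>) * Z (click_pattern I \<omega>) \<omega>)"
    and "integrable M (\<lambda>\<omega>. current_prob I t i \<omega> * Z (click_pattern I \<omega>) \<omega>)"
    and "(\<integral>\<omega>. of_bool (click I t i \<omega>) * Z (click_pattern I \<omega>) \<omega> \<partial>M) =
      (\<integral>\<omega>. current_prob I t i \<omega> * Z (click_pattern I \<omega>) \<omega> \<partial>M)"
proof -
  let ?X = "\<lambda>S \<omega>. of_bool ((t, i) \<in> S) * Z S \<omega>"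
  let ?P = "\<lambda>S \<omega>. current_prob I t i \<omega> * Z S \<omega>"
  have click: "click I t i \<omega> \<longleftrightarrow> (t, i) \<in> click_pattern I \<omega>" for \<omega>
    using t i by (simp add: click_pattern_def slots_def)
  have X: "?X S \<in> borel_measurable F" for S
    by (intro borel_measurable_times Z) simp
  have P: "?P S \<in> borel_measurable F" for S
    by (intro borel_measurable_times Z measurable_current_prob t i)
  have KX: "\<bar>?X S \<omega>\<bar> \<le> K" if "\<omega> \<in> space M" for S \<omega>
    using K[OF that, of S] by (auto simp: of_bool_def)
  have KP: "\<bar>?P S \<omega>\<bar> \<le> 1 * K" if "\<omega> \<in> space M" for S \<omega>
    unfolding abs_mult using K[OF that, of S] current_prob_bounds[OF t i that]
    by (intro mult_mono) auto
  show "integrable M (\<lambda>\<omega>. of_bool (click I t i \<omega>) * Z (click_pattern I \<omega>) \<omega>)"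
    unfolding click by (rule integral_click_pattern(1)[of ?X, OF X KX])
  show "integrable M (\<lambda>\<omega>. current_prob I t i \<omega> * Z (click_pattern I \<omega>) \<omega>)"
    by (rule integral_click_pattern(1)[of ?P, OF P KP])
  have "(\<integral>\<omega>. ?X (click_pattern I \<omega>) \<omega> \<partial>M) =
      (\<integral>\<omega>. (\<Sum>S\<in>Pow (slots I). pattern_prob I S \<omega> * ?X S \<omega>) \<partial>M)"
    by (rule integral_click_pattern(2)[of ?X, OF X KX])
  also have "\<dots> = (\<integral>\<omega>. (\<Sum>S\<in>Pow (slots I). pattern_prob I S \<omega> * ?P S \<omega>) \<partial>M)"
  proof (rule Bochner_Integration.integral_cong[OF refl])
    fix \<omega> assume "\<omega> \<in> space M"
    then show "(\<Sum>S\<in>Pow (slots I). pattern_prob I S \<omega> * ?X S \<omega>) =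
        (\<Sum>S\<in>Pow (slots I). pattern_prob I S \<omega> * ?P S \<omega>)"
      using bernoulli_pattern_sum[of "slots I" "(t, i)" "\<lambda>S. Z S \<omega>"
          "\<lambda>d. current_prob I (fst d) (snd d) \<omega>"] t i free
      by (simp add: pattern_prob_def slots_def)
  qed
  also have "\<dots> = (\<integral>\<omega>. ?P (click_pattern I \<omega>) \<omega> \<partial>M)"
    by (rule integral_click_pattern(2)[of ?P, OF P KP, symmetric])
  finally show "(\<integral>\<omega>. of_bool (click I t i \<omega>) * Z (click_pattern I \<omega>) \<omega> \<partial>M) =
      (\<integral>\<omega>. ?P (click_pattern I \<omega>) \<omega> \<partial>M)"
    unfolding click .
qed

section \<open>Expected revenues\<close>

lemma integral_collected:
  assumes \<rho>: "adaptive_policy I \<rho>" and \<mu>: "adaptive_policy I \<mu>"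
    and t: "t < horizon I" and i: "i < num_adv I"
  defines "val \<equiv> \<lambda>\<omega>. current_prob I t i \<omega> *
    (of_bool (i \<in> assigned I \<rho> t \<omega>) * min (current_value I t i \<omega>) (remaining I \<mu> t i \<omega>))"
  shows "integrable M (collected I \<rho> \<mu> t i)"
    and "integrable M val"
    and "(\<integral>\<omega>. collected I \<rho> \<mu> t i \<omega> \<partial>M) = (\<integral>\<omega>. val \<omega> \<partial>M)"
proof -
  let ?J = "with_clicks I"
  \<comment> \<open>\<open>Z S\<close> is the fictitious payment upon a click in slot \<open>(t, i)\<close>, had the click pattern been \<open>S\<close>.\<close>
  define Z where "Z S \<omega> = of_bool (i \<in> assigned (?J S) \<rho> t \<omega>) *
    min (current_value I t i \<omega>) (remaining (?J S) \<mu> t i \<omega>)" for S \<omega>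
  have "Z S \<in> borel_measurable F" for S
  proof -
    have [measurable]: "Measurable.pred F (\<lambda>\<omega>. i \<in> assigned (?J S) \<rho> t \<omega>)"
      by (rule measurable_compose[OF measurable_assigned[OF \<rho> t]]) simp
    note [measurable] = measurable_current_value[OF t]
      measurable_remaining[OF \<mu> less_imp_le[OF t]]
    show ?thesis unfolding Z_def by measurable
  qed
  moreover have "\<bar>Z S \<omega>\<bar> \<le> budget I i" if "\<omega> \<in> space M" for S \<omega>
    using remaining_bounds[of "?J S" i t \<omega> \<mu>] budget_nonneg[OF i]
      current_value_nonneg[OF _ i that] t
    by (auto simp: Z_def of_bool_def min_def)
  moreover have "Z (insert (t, i) S) \<omega> = Z S \<omega>" if "\<omega> \<in> space M" for S \<omega>
    using assigned_with_clicks[of t \<rho> \<omega> "?J S" "insert (t, i) S"]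
      remaining_with_clicks[of i "?J S" t \<mu> \<omega> "insert (t, i) S"]
      adaptive_subset[OF \<rho> _ that] adaptive_subset[OF \<mu> _ that] t i
    by (simp add: Z_def)
  ultimately have int_X: "integrable M (\<lambda>\<omega>. of_bool (click I t i \<omega>) * Z (click_pattern I \<omega>) \<omega>)"
    and int_P: "integrable M (\<lambda>\<omega>. current_prob I t i \<omega> * Z (click_pattern I \<omega>) \<omega>)"
    and eq: "(\<integral>\<omega>. of_bool (click I t i \<omega>) * Z (click_pattern I \<omega>) \<omega> \<partial>M) =
      (\<integral>\<omega>. current_prob I t i \<omega> * Z (click_pattern I \<omega>) \<omega> \<partial>M)"
    using integral_click[OF t i, of Z "budget I i"] by blast+
  have Z_pattern: "Z (click_pattern I \<omega>) \<omega> = of_bool (i \<in> assigned I \<rho> t \<omega>) *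
      min (current_value I t i \<omega>) (remaining I \<mu> t i \<omega>)" if "\<omega> \<in> space M" for \<omega>
    using assigned_with_clicks[of t \<rho> \<omega> I "click_pattern I \<omega>"]
      remaining_with_clicks[of i I t \<mu> \<omega> "click_pattern I \<omega>"]
      adaptive_subset[OF \<rho> _ that] adaptive_subset[OF \<mu> _ that] t i
    by (simp add: Z_def click_pattern_def slots_def)
  have X: "of_bool (click I t i \<omega>) * Z (click_pattern I \<omega>) \<omega> = collected I \<rho> \<mu> t i \<omega>"
    and P: "current_prob I t i \<omega> * Z (click_pattern I \<omega>) \<omega> = val \<omega>"
    if "\<omega> \<in> space M" for \<omega>
    using Z_pattern[OF that] by (auto simp: collected_def charge_def val_def)
  show "integrable M (collected I \<rho> \<mu> t i)"
    using int_X X by (simp cong: Bochner_Integration.integrable_cong)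
  show "integrable M val"
    using int_P P by (simp cong: Bochner_Integration.integrable_cong)
  show "(\<integral>\<omega>. collected I \<rho> \<mu> t i \<omega> \<partial>M) = (\<integral>\<omega>. val \<omega> \<partial>M)"
    using eq X P by (simp cong: Bochner_Integration.integral_cong)
qed

lemma period_value_assigned:
  assumes "adaptive_policy I \<rho>" and "t < horizon I" and "\<omega> \<in> space M"
  shows "period_value I \<mu> t \<omega> (assigned I \<rho> t \<omega>) =
    (\<Sum>i<num_adv I. current_prob I t i \<omega> * (of_bool (i \<in> assigned I \<rho> t \<omega>) *
      min (current_value I t i \<omega>) (remaining I \<mu> t i \<omega>)))"
proof -
  have "assigned I \<rho> t \<omega> \<subseteq> {..<num_adv I}"
    unfolding assigned_def by (rule adaptive_subset[OF assms])
  then show ?thesis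
    unfolding period_value_def
    by (intro sum.mono_neutral_cong_left) auto
qed

lemma integral_sum_collected:
  assumes "adaptive_policy I \<rho>" "adaptive_policy I \<mu>" "t < horizon I"
  shows "integrable M (\<lambda>\<omega>. period_value I \<mu> t \<omega> (assigned I \<rho> t \<omega>))"
    and "(\<Sum>i<num_adv I. \<integral>\<omega>. collected I \<rho> \<mu> t i \<omega> \<partial>M) =
      (\<integral>\<omega>. period_value I \<mu> t \<omega> (assigned I \<rho> t \<omega>) \<partial>M)"
proof -
  note collected = integral_collected[OF assms]
  note cong = period_value_assigned[OF assms(1,3)]
  show "integrable M (\<lambda>\<omega>. period_value I \<mu> t \<omega> (assigned I \<rho> t \<omega>))"
    by (subst Bochner_Integration.integrable_cong[OF refl cong])
       (auto intro!: Bochner_Integration.integrable_sum collected(2))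
  have "(\<integral>\<omega>. period_value I \<mu> t \<omega> (assigned I \<rho> t \<omega>) \<partial>M) =
      (\<Sum>i<num_adv I. \<integral>\<omega>. current_prob I t i \<omega> * (of_bool (i \<in> assigned I \<rho> t \<omega>) *
        min (current_value I t i \<omega>) (remaining I \<mu> t i \<omega>)) \<partial>M)"
    by (subst Bochner_Integration.integral_cong[OF refl cong])
       (auto intro!: Bochner_Integration.integral_sum collected(2))
  then show "(\<Sum>i<num_adv I. \<integral>\<omega>. collected I \<rho> \<mu> t i \<omega> \<partial>M) =
      (\<integral>\<omega>. period_value I \<mu> t \<omega> (assigned I \<rho> t \<omega>) \<partial>M)"
    using collected(3) by simp
qed

lemma expected_revenue_eq:
  assumes "adaptive_policy I \<rho>"
  shows "integrable M (revenue I \<rho>)"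
    and "expected_revenue I \<rho> = (\<Sum>t<horizon I. \<integral>\<omega>. period_value I \<rho> t \<omega> (assigned I \<rho> t \<omega>) \<partial>M)"
proof -
  have eq: "revenue I \<rho> \<omega> = (\<Sum>t<horizon I. \<Sum>i<num_adv I. collected I \<rho> \<rho> t i \<omega>)"
    if "\<omega> \<in> space M" for \<omega>
    using revenue_eq_spent[of I \<omega> \<rho>] budget_nonneg current_value_nonneg that
    by (subst sum.swap) (simp add: collected_self sum_payment)
  note int = integral_collected(1)[OF assms assms]
  have "integrable M (\<lambda>\<omega>. \<Sum>t<horizon I. \<Sum>i<num_adv I. collected I \<rho> \<rho> t i \<omega>)"
    using int by (intro integral_double_sum(1)) auto
  then show "integrable M (revenue I \<rho>)"
    using eq by (simp cong: Bochner_Integration.integrable_cong)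
  have "expected_revenue I \<rho> = (\<integral>\<omega>. (\<Sum>t<horizon I. \<Sum>i<num_adv I. collected I \<rho> \<rho> t i \<omega>) \<partial>M)"
    unfolding expected_revenue_def using eq by (intro Bochner_Integration.integral_cong) auto
  also have "\<dots> = (\<Sum>t<horizon I. \<Sum>i<num_adv I. \<integral>\<omega>. collected I \<rho> \<rho> t i \<omega> \<partial>M)"
    using int by (intro integral_double_sum(2)) auto
  also have "\<dots> = (\<Sum>t<horizon I. \<integral>\<omega>. period_value I \<rho> t \<omega> (assigned I \<rho> t \<omega>) \<partial>M)"
    using integral_sum_collected(2)[OF assms assms] by simp
  finally show "expected_revenue I \<rho> =
      (\<Sum>t<horizon I. \<integral>\<omega>. period_value I \<rho> t \<omega> (assigned I \<rho> t \<omega>) \<partial>M)" .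
qed

lemma expected_revenue_le_myopic:
  assumes \<pi>: "adaptive_policy I \<pi>" and myopic: "myopic_policy I \<mu>"
  shows "expected_revenue I \<pi> \<le> 2 * expected_revenue I \<mu>"
proof -
  have \<mu>: "adaptive_policy I \<mu>"
    using myopic by (simp add: myopic_policy_def)
  note int = integral_collected(1)[OF \<pi> \<mu>]
  have int_sum: "integrable M (\<lambda>\<omega>. \<Sum>i<num_adv I. \<Sum>t<horizon I. collected I \<pi> \<mu> t i \<omega>)"
    using int by (intro integral_double_sum(1)) auto
  have "expected_revenue I \<pi> \<le>
      (\<integral>\<omega>. (\<Sum>i<num_adv I. \<Sum>t<horizon I. collected I \<pi> \<mu> t i \<omega>) + revenue I \<mu> \<omega> \<partial>M)"
    unfolding expected_revenue_def
    using budget_nonneg current_value_nonneg int_sum expected_revenue_eq(1)[OF \<pi>]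
      expected_revenue_eq(1)[OF \<mu>]
    by (intro integral_mono revenue_le_collected Bochner_Integration.integrable_add) auto
  also have "\<dots> = (\<Sum>i<num_adv I. \<Sum>t<horizon I. \<integral>\<omega>. collected I \<pi> \<mu> t i \<omega> \<partial>M) +
      expected_revenue I \<mu>"
    using int_sum expected_revenue_eq(1)[OF \<mu>] int
      integral_double_sum(2)[of "{..<num_adv I}" "{..<horizon I}" M "\<lambda>i t. collected I \<pi> \<mu> t i"]
    by (simp add: expected_revenue_def)
  also have "(\<Sum>i<num_adv I. \<Sum>t<horizon I. \<integral>\<omega>. collected I \<pi> \<mu> t i \<omega> \<partial>M) =
      (\<Sum>t<horizon I. \<integral>\<omega>. period_value I \<mu> t \<omega> (assigned I \<pi> t \<omega>) \<partial>M)"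
    using integral_sum_collected(2)[OF \<pi> \<mu>] by (subst sum.swap) simp
  also have "\<dots> \<le> (\<Sum>t<horizon I. \<integral>\<omega>. period_value I \<mu> t \<omega> (assigned I \<mu> t \<omega>) \<partial>M)"
  proof (intro sum_mono integral_mono)
    fix t \<omega> assume t: "t \<in> {..<horizon I}" and \<omega>: "\<omega> \<in> space M"
    have "assigned I \<pi> t \<omega> \<in> assignments I"
      unfolding assigned_def using t by (intro adaptive_assigns[OF \<pi> _ \<omega>]) simp
    then show "period_value I \<mu> t \<omega> (assigned I \<pi> t \<omega>) \<le> period_value I \<mu> t \<omega> (assigned I \<mu> t \<omega>)"
      using myopic t \<omega> by (simp add: myopic_policy_def)
  qed (use integral_sum_collected(1) \<pi> \<mu> in auto)
  also have "\<dots> = expected_revenue I \<mu>"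
    by (rule expected_revenue_eq(2)[OF \<mu>, symmetric])
  finally show ?thesis by simp
qed

end

theorem corollary3:
  fixes I :: "'w adwords" and \<mu> :: "'w rule"
  assumes "cpc_adwords I" and "myopic_policy I \<mu>"
  shows "1 / 2 * optimal_revenue I \<le> expected_revenue I \<mu>"
proof -
  interpret cpc_instance I
    by unfold_locales (rule assms(1))
  have "optimal_revenue I \<le> 2 * expected_revenue I \<mu>"
    unfolding optimal_revenue_def
    using adaptive_policy_empty expected_revenue_le_myopic[OF _ assms(2)]
    by (intro cSUP_least) blast+
  then show ?thesis by simp
qed

end
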